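(* Let $H$ be a group acting ergodically on a probability space $(X,\mu)$, with a fixed norm on $H$ whose balls have growth exponents $d_H^-\le d_H^+$, and let $\{A_t\}_{t\ge 1}$ be a decreasing family of measurable subsets of $X$ with $\mu(A_t)\asymp 1/t$. Assuming the $H$ action on $X$ satisfies an effective mean ergodic theorem with exponent $\kappa$, we have the lower bound $$\alpha_{H,A}\ge 2\kappa\, d_H^-$$ for the critical exponent $\alpha_{H,A}$.
   Context: Notation: $F(t)\ll G(t)$ means $F(t)\le cG(t)$ for some constant $c>0$ (subscripts indicate what $c$ depends on), and $F(t)\asymp G(t)$ means $c^{-1}F(t)\le G(t)\le cF(t)$ for some constant $c>1$. The action of $H$ on $X$ is written on the right, $x\mapsto xh$, and it leads to a unitary representation of $H$ on $L^2(X)$. $m$ denotes Haar measure on $H$. A norm $\|\cdot\|$ on $H$ is fixed and $H_t=\{h\in H:\|h\|\le t\}$. Bounded subsets of $H$ are bounded with respect to this norm. Growth exponents: $d_H^-\le d_H^+$ are such that for any $\epsilon>0$, $t^{d_H^--\epsilon}\ll_\epsilon m(H_t)\ll_\epsilon t^{d_H^++\epsilon}$. Critical exponent: for $x\in X$, $\alpha(x)=\alpha_{H,A}(x)$ is the infimum over all $\eta\ge 0$ such that the set $\{h\in H: xh\in A_{\|h\|^\eta}\}$ is bounded, if such an exponent exists. Under mild regularity assumptions on the norm (namely $\|h_0h\|\asymp_{h_0}\|h\|$ for any $h_0,h\in H$), $\alpha(x)$ is invariant under the $H$ action, hence by ergodicity constant almost everywhere; $\alpha_{H,A}$ denotes this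 constant. Effective mean ergodic theorem with exponent $\kappa>0$: for $f\in L^2(X)$ put $\pi_t(f)(x)=\frac{1}{m(H_t)}\int_{H_t}f(xh)\,dm(h)$; the condition is that for any $f\in L^2(X)$, $\|\pi_t f-\int_X f\,d\mu\|_2\ll_\kappa m(H_t)^{-\kappa}\|f\|_2$. *)

theory Defs
  imports "HOL-Probability.Probability" "HOL-Library.Landau_Symbols"
begin

text \<open>The group \<open>H\<close> is a type of class \<^class>\<open>topological_group_add\<close>. It is
  written additively, as in that class, but it is not assumed to be commutative.\<close>

definition radon_measure :: "'h::t2_space measure \<Rightarrow> bool" where
  "radon_measure m \<longleftrightarrow>
     sets m = sets borel \<and>
     (\<forall>K. compact K \<longrightarrow> emeasure m K < \<infinity>) \<and>
     (\<forall>B\<in>sets borel. emeasure m B = (INF U\<in>{U. open U \<and> B \<subseteq> U}. emeasure m U)) \<and>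
     (\<forall>U. open U \<longrightarrow> emeasure m U = (SUP K\<in>{K. compact K \<and> K \<subseteq> U}. emeasure m K))"

definition left_haar_measure :: "'h::{topological_group_add,t2_space} measure \<Rightarrow> bool" where
  "left_haar_measure m \<longleftrightarrow>
     radon_measure m \<and> emeasure m UNIV \<noteq> 0 \<and> (\<forall>g. distr m borel (\<lambda>h. g + h) = m)"

definition right_haar_measure :: "'h::{topological_group_add,t2_space} measure \<Rightarrow> bool" where
  "right_haar_measure m \<longleftrightarrow>
     radon_measure m \<and> emeasure m UNIV \<noteq> 0 \<and> (\<forall>g. distr m borel (\<lambda>h. h + g) = m)"

text \<open>\<open>act x h\<close> is the point \<open>xh\<close>.\<close>

definition measure_preserving_right_action ::
    "'x measure \<Rightarrow> ('x \<Rightarrow> 'h::topological_group_add \<Rightarrow> 'x) \<Rightarrow> bool" where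
  "measure_preserving_right_action M act \<longleftrightarrow>
     (\<lambda>(x, h). act x h) \<in> M \<Otimes>\<^sub>M borel \<rightarrow>\<^sub>M M \<and>
     (\<forall>x\<in>space M. act x 0 = x) \<and>
     (\<forall>x\<in>space M. \<forall>g h. act x (g + h) = act (act x g) h) \<and>
     (\<forall>h. distr M M (\<lambda>x. act x h) = M)"

definition ergodic_right_action ::
    "'x measure \<Rightarrow> ('x \<Rightarrow> 'h::topological_group_add \<Rightarrow> 'x) \<Rightarrow> bool" where
  "ergodic_right_action M act \<longleftrightarrow>
     measure_preserving_right_action M act \<and>
     (\<forall>B\<in>sets M. (\<forall>h. (\<lambda>x. act x h) -` B \<inter> space M = B) \<longrightarrow>
        measure M B = 0 \<or> measure M B = 1)"

text \<open>No axioms relating \<open>N\<close> to the group structure are imposed on a norm \<open>N\<close>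
  (matrix norms, for example, are not subadditive with respect to the group law).\<close>

definition group_norm :: "('h::topological_space \<Rightarrow> real) \<Rightarrow> bool" where
  "group_norm N \<longleftrightarrow> N \<in> borel_measurable borel \<and> (\<forall>h. 0 \<le> N h)"

definition norm_ball :: "('h \<Rightarrow> real) \<Rightarrow> real \<Rightarrow> 'h set" where
  "norm_ball N t = {h. N h \<le> t}"

text \<open>The growth bounds are for all large \<open>t\<close>, since balls of small radius may be empty.\<close>

definition growth_exponents ::
    "'h measure \<Rightarrow> ('h \<Rightarrow> real) \<Rightarrow> real \<Rightarrow> real \<Rightarrow> bool" where
  "growth_exponents m N d_minus d_plus \<longleftrightarrow>
     d_minus \<le> d_plus \<and>
     (\<forall>t. emeasure m (norm_ball N t) < \<infinity>) \<and>
     (\<forall>\<epsilon>>0. (\<lambda>t. t powr (d_minus - \<epsilon>)) \<in> O(\<lambda>t. measure m (norm_ball N t)) \<and>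
            (\<lambda>t. measure m (norm_ball N t)) \<in> O(\<lambda>t. t powr (d_plus + \<epsilon>)))"

definition shrinking_targets :: "'x measure \<Rightarrow> (real \<Rightarrow> 'x set) \<Rightarrow> bool" where
  "shrinking_targets M A \<longleftrightarrow>
     (\<forall>t\<ge>1. A t \<in> sets M) \<and>
     (\<forall>s t. 1 \<le> s \<longrightarrow> s \<le> t \<longrightarrow> A t \<subseteq> A s) \<and>
     (\<exists>c>1. \<forall>t\<ge>1. 1 / (c * t) \<le> measure M (A t) \<and> measure M (A t) \<le> c / t)"

definition L2_space :: "'x measure \<Rightarrow> ('x \<Rightarrow> complex) set" where
  "L2_space M = {f \<in> borel_measurable M. integrable M (\<lambda>x. (cmod (f x))\<^sup>2)}"

definition L2_norm :: "'x measure \<Rightarrow> ('x \<Rightarrow> complex) \<Rightarrow> real" where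
  "L2_norm M f = sqrt (\<integral>x. (cmod (f x))\<^sup>2 \<partial>M)"

definition ball_average ::
    "'h measure \<Rightarrow> ('h \<Rightarrow> real) \<Rightarrow> ('x \<Rightarrow> 'h \<Rightarrow> 'x) \<Rightarrow> real \<Rightarrow> ('x \<Rightarrow> complex) \<Rightarrow> 'x \<Rightarrow> complex" where
  "ball_average m N act t f x =
     (LINT h:norm_ball N t|m. f (act x h)) / of_real (measure m (norm_ball N t))"

text \<open>Radii whose ball is a null set are excluded, as the average is not defined for them.\<close>

definition effective_mean_ergodic ::
    "'x measure \<Rightarrow> 'h measure \<Rightarrow> ('h \<Rightarrow> real) \<Rightarrow> ('x \<Rightarrow> 'h \<Rightarrow> 'x) \<Rightarrow> real \<Rightarrow> bool" where
  "effective_mean_ergodic M m N act \<kappa> \<longleftrightarrow>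
     \<kappa> > 0 \<and>
     (\<exists>C>0. \<forall>f\<in>L2_space M. \<forall>t. measure m (norm_ball N t) > 0 \<longrightarrow>
        L2_norm M (\<lambda>x. ball_average m N act t f x - (\<integral>y. f y \<partial>M))
          \<le> C * measure m (norm_ball N t) powr (- \<kappa>) * L2_norm M f)"

text \<open>The condition \<open>1 \<le> N h powr \<eta>\<close> keeps the index of \<open>A\<close> in the range where the
  family is given; it removes only elements \<open>h\<close> with \<open>N h < 1\<close>, hence does not affect
  boundedness.\<close>

definition hitting_set ::
    "('h \<Rightarrow> real) \<Rightarrow> ('x \<Rightarrow> 'h \<Rightarrow> 'x) \<Rightarrow> (real \<Rightarrow> 'x set) \<Rightarrow> real \<Rightarrow> 'x \<Rightarrow> 'h set" where
  "hitting_set N act A \<eta> x = {h. 1 \<le> N h powr \<eta> \<and> act x h \<in> A (N h powr \<eta>)}"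

text \<open>The value is \<open>\<infinity>\<close> if the hitting set is unbounded for every \<open>\<eta>\<close>.\<close>

definition critical_exponent_at ::
    "('h \<Rightarrow> real) \<Rightarrow> ('x \<Rightarrow> 'h \<Rightarrow> 'x) \<Rightarrow> (real \<Rightarrow> 'x set) \<Rightarrow> 'x \<Rightarrow> ereal" where
  "critical_exponent_at N act A x =
     (INF \<eta>\<in>{\<eta>. 0 \<le> \<eta> \<and> bdd_above (N ` hitting_set N act A \<eta> x)}. ereal \<eta>)"

definition is_critical_exponent ::
    "'x measure \<Rightarrow> ('h \<Rightarrow> real) \<Rightarrow> ('x \<Rightarrow> 'h \<Rightarrow> 'x) \<Rightarrow> (real \<Rightarrow> 'x set) \<Rightarrow> ereal \<Rightarrow> bool" where
  "is_critical_exponent M N act A \<alpha> \<longleftrightarrow> (AE x in M. critical_exponent_at N act A x = \<alpha>)"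

lemma is_critical_exponent_unique:
  assumes "prob_space M" "is_critical_exponent M N act A \<alpha>" "is_critical_exponent M N act A \<beta>"
  shows "\<alpha> = \<beta>"
proof -
  interpret prob_space M by fact
  have "AE x in M. \<alpha> = \<beta>"
    using assms(2,3) unfolding is_critical_exponent_def by eventually_elim simp
  then show ?thesis by simp
qed

text \<open>The regularity of the norm that makes the critical exponent invariant.\<close>

definition regular_norm :: "('h::plus \<Rightarrow> real) \<Rightarrow> bool" where
  "regular_norm N \<longleftrightarrow> (\<forall>g. \<exists>c>1. \<forall>h. N h / c \<le> N (g + h) \<and> N (g + h) \<le> c * N h)"

lemma act_in_space:
  assumes act: "measure_preserving_right_action M act" and x: "x \<in> space M"
  shows "act x h \<in> space M"
proof -
  have "(\<lambda>(x, h). act x h) \<in> M \<Otimes>\<^sub>M borel \<rightarrow>\<^sub>M M"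
    using act by (simp add: measure_preserving_right_action_def)
  from measurable_space[OF this, of "(x, h)"] show ?thesis
    using x by (simp add: space_pair_measure)
qed

lemma critical_exponent_at_act_ge:
  fixes N :: "'h::topological_group_add \<Rightarrow> real"
  assumes act: "measure_preserving_right_action M act"
    and N: "\<And>h. 0 \<le> N h" "regular_norm N" and A: "shrinking_targets M A" and x: "x \<in> space M"
  shows "critical_exponent_at N act A x \<le> critical_exponent_at N act A (act x g)"
proof -
  obtain c where c: "c > 1" "\<And>h. N h / c \<le> N (- g + h)" "\<And>h. N (- g + h) \<le> c * N h"
    using N(2) unfolding regular_norm_def by metis
  have *: "bdd_above (N ` hitting_set N act A (\<eta> + e) x)"
    if eta: "0 \<le> \<eta>" and bdd: "bdd_above (N ` hitting_set N act A \<eta> (act x g))" and e: "e > 0"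
    for \<eta> e
  proof -
    obtain R where R: "\<And>k. k \<in> hitting_set N act A \<eta> (act x g) \<Longrightarrow> N k \<le> R"
      using bdd by (auto simp: bdd_above_def)
    define T where "T = max c (c powr (\<eta> / e))"
    have "N h \<le> max T (c * R)" if h: "h \<in> hitting_set N act A (\<eta> + e) x" for h
    proof (cases "N h \<le> T")
      case False
      then have T: "c < N h" "c powr (\<eta> / e) < N h" by (auto simp: T_def)
      define k where "k = - g + h"
      have actk: "act (act x g) k = act x h"
        using act x unfolding measure_preserving_right_action_def k_def
        by (metis add.assoc add.right_inverse add_0_left)
      have k1: "1 \<le> N k"
        using c(1) c(2)[of h] T(1) unfolding k_def
        by (smt (verit) le_divide_eq_1_pos)
      have "(c powr (\<eta> / e)) powr e \<le> N h powr e"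
        using T e c(1) by (intro powr_mono2) auto
      then have ce: "c powr \<eta> \<le> N h powr e"
        using e by (simp add: powr_powr)
      have "N k powr \<eta> \<le> (c * N h) powr \<eta>"
        using c(3)[of h] k1 eta unfolding k_def by (intro powr_mono2) auto
      also have "\<dots> = c powr \<eta> * N h powr \<eta>"
        using c(1) N(1) by (simp add: powr_mult)
      also have "\<dots> \<le> N h powr e * N h powr \<eta>"
        by (intro mult_right_mono ce) auto
      also have "\<dots> = N h powr (\<eta> + e)"
        by (simp add: powr_add mult.commute)
      finally have le: "N k powr \<eta> \<le> N h powr (\<eta> + e)" .
      have one: "1 \<le> N k powr \<eta>"
        using k1 eta by (simp add: ge_one_powr_ge_zero)
      have "act x h \<in> A (N k powr \<eta>)"
        using A h le one unfolding shrinking_targets_def hitting_set_def by blast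
      then have "k \<in> hitting_set N act A \<eta> (act x g)"
        using one actk by (simp add: hitting_set_def)
      then have "N k \<le> R" by (rule R)
      then have "N h / c \<le> R" using c(2)[of h] unfolding k_def by linarith
      then have "N h \<le> c * R" using c(1) by (simp add: field_simps)
      then show ?thesis by simp
    qed simp
    then show ?thesis by (auto simp: bdd_above_def)
  qed
  show ?thesis
    unfolding critical_exponent_at_def[of N act A "act x g"]
  proof (rule INF_greatest)
    fix \<eta> assume eta: "\<eta> \<in> {\<eta>. 0 \<le> \<eta> \<and> bdd_above (N ` hitting_set N act A \<eta> (act x g))}"
    have le: "critical_exponent_at N act A x \<le> ereal (\<eta> + e)" if "e > 0" for e
      unfolding critical_exponent_at_def
      using eta *[of \<eta> e] that by (intro INF_lower) auto
    show "critical_exponent_at N act A x \<le> ereal \<eta>"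
      by (rule ereal_le_epsilon2) (use le in simp)
  qed
qed

lemma critical_exponent_at_act:
  fixes N :: "'h::topological_group_add \<Rightarrow> real"
  assumes act: "measure_preserving_right_action M act"
    and N: "\<And>h. 0 \<le> N h" "regular_norm N" and A: "shrinking_targets M A" and x: "x \<in> space M"
  shows "critical_exponent_at N act A (act x g) = critical_exponent_at N act A x"
proof (rule antisym)
  have xg: "act x g \<in> space M"
    by (rule act_in_space[OF act x])
  have "act (act x g) (- g) = x"
    using act x unfolding measure_preserving_right_action_def by (metis add.right_inverse)
  then show "critical_exponent_at N act A (act x g) \<le> critical_exponent_at N act A x"
    using critical_exponent_at_act_ge[OF act N A xg, of "- g"] by simp
qed (rule critical_exponent_at_act_ge[OF assms])

text \<open>Existence of the critical exponent. The measurability assumption is needed because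
  the sets where a hitting set is bounded involve an uncountable quantifier over \<open>H\<close>.\<close>

lemma is_critical_exponent_exists:
  fixes N :: "'h::topological_group_add \<Rightarrow> real"
  assumes M: "prob_space M" and act: "ergodic_right_action M act"
    and N: "\<And>h. 0 \<le> N h" "regular_norm N" and A: "shrinking_targets M A"
    and meas: "critical_exponent_at N act A \<in> borel_measurable M"
  shows "\<exists>\<alpha>. is_critical_exponent M N act A \<alpha>"
proof -
  interpret prob_space M by fact
  let ?f = "critical_exponent_at N act A"
  let ?a = "esssup M ?f"
  have mp: "measure_preserving_right_action M act"
    using act by (simp add: ergodic_right_action_def)
  have lower: "AE x in M. z < ?f x" if z: "z < ?a" for z
  proof -
    let ?B = "{x \<in> space M. z < ?f x}"
    have B: "?B \<in> sets M" using meas by measurable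
    have "\<forall>h. (\<lambda>x. act x h) -` ?B \<inter> space M = ?B"
      using critical_exponent_at_act[OF mp N A] act_in_space[OF mp] by auto
    then have "measure M ?B = 0 \<or> measure M ?B = 1"
      using act B unfolding ergodic_right_action_def by blast
    moreover have "emeasure M ?B > 0"
      by (rule esssup_pos_measure[OF meas z])
    ultimately have "prob ?B = 1"
      by (auto simp: emeasure_eq_measure)
    then show ?thesis
      using B by (simp add: prob_Collect_eq_1)
  qed
  have "AE x in M. \<forall>q::rat. ereal (of_rat q) < ?a \<longrightarrow> ereal (of_rat q) < ?f x"
    using lower by (subst AE_all_countable) (auto intro: AE_I2)
  moreover have "AE x in M. ?f x \<le> ?a" by (rule esssup_AE)
  ultimately have "AE x in M. ?f x = ?a"
  proof eventually_elim
    case (elim x)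
    show ?case
    proof (rule ccontr)
      assume "?f x \<noteq> ?a"
      then have "?f x < ?a" using elim by simp
      then obtain q :: rat where "?f x < ereal (of_rat q)" "ereal (of_rat q) < ?a"
        using ereal_dense3 by blast
      then show False using elim by (meson less_asym)
    qed
  qed
  then show ?thesis unfolding is_critical_exponent_def by blast
qed

end

theory Submission
  imports Defs
begin

text \<open>Suppose that the critical exponent is less than \<open>\<eta> < 2 \<kappa> d\<close>. Then there are \<open>R\<close> and a set \<open>B\<close>
  of measure \<open>b > 0\<close> such that, for \<open>x \<in> B\<close> and all \<open>n\<close>, almost every \<open>h \<in> H\<^sub>n\<close> with \<open>xh \<in> A\<^sub>t\<close>,
  \<open>t = n\<^sup>\<eta>\<close>, lies in \<open>H\<^sub>R\<close>. By invariance of the measure such visits to \<open>H\<^sub>R\<close> have total mass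
  \<open>m(H\<^sub>R) a\<close>, where \<open>a = \<mu>(A\<^sub>t)\<close>. The ergodic average of the indicator of \<open>A\<^sub>t\<close> hence
  has integral at most \<open>m(H\<^sub>R) a / m(H\<^sub>n)\<close> over \<open>B\<close>, while the mean ergodic theorem makes that
  integral at least \<open>b a - C m(H\<^sub>n)\<^sup>-\<^sup>\<kappa> \<surd>a\<close>. Since \<open>m(H\<^sub>n) \<rightarrow> \<infinity>\<close>, this forces
  \<open>\<surd>a\<close> to be at most of order \<open>m(H\<^sub>n)\<^sup>-\<^sup>\<kappa>\<close>, which is false for \<open>\<eta> < 2 \<kappa> d\<close> and large \<open>n\<close>.
  Counting visits in the mean over \<open>B\<close> rather than pointwise is what allows \<open>\<kappa> > 1/2\<close>.\<close>

section \<open>Group elements carrying a point into a target\<close>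

definition visits :: "('x \<Rightarrow> 'h \<Rightarrow> 'x) \<Rightarrow> 'h set \<Rightarrow> 'x set \<Rightarrow> 'x \<Rightarrow> 'h set" where
  "visits act S B x = {h \<in> S. act x h \<in> B}"

lemma norm_ball_sets_borel:
  assumes "group_norm N"
  shows "norm_ball N t \<in> sets borel"
proof -
  have [measurable]: "N \<in> borel_measurable borel"
    using assms by (simp add: group_norm_def)
  show ?thesis unfolding norm_ball_def by measurable
qed

text \<open>A Haar measure need not be sigma-finite. Balls of finite measure exhaust the group
  because the norm is real-valued, and this gives access to Tonelli's theorem.\<close>

lemma sigma_finite_if_finite_balls:
  assumes "sets m = sets borel" "group_norm N" "\<And>t. emeasure m (norm_ball N t) < \<infinity>"
  shows "sigma_finite_measure m"
proof
  have "space m = UNIV"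
    using sets_eq_imp_space_eq[OF assms(1)] by simp
  moreover have "(\<Union>n. norm_ball N (real n)) = UNIV"
    by (auto simp: norm_ball_def real_arch_simple)
  ultimately show "\<exists>\<A>. countable \<A> \<and> \<A> \<subseteq> sets m \<and> \<Union> \<A> = space m \<and> (\<forall>a\<in>\<A>. emeasure m a \<noteq> \<infinity>)"
    using assms norm_ball_sets_borel[OF assms(2)]
    by (intro exI[of _ "range (\<lambda>n. norm_ball N (real n))"]) (auto simp: less_top)
qed

locale sigma_finite_action = M: sigma_finite_measure M + m: sigma_finite_measure m
  for M :: "'x measure" and m :: "'h::topological_group_add measure" +
  fixes act :: "'x \<Rightarrow> 'h \<Rightarrow> 'x"
  assumes sets_m: "sets m = sets borel"
    and action: "measure_preserving_right_action M act"
begin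

lemma act_measurable: "(\<lambda>(x, h). act x h) \<in> M \<Otimes>\<^sub>M m \<rightarrow>\<^sub>M M"
  unfolding measurable_cong_sets[OF sets_pair_measure_cong[OF refl sets_m] refl]
  using action by (simp add: measure_preserving_right_action_def)

lemma space_m: "space m = UNIV"
  using sets_eq_imp_space_eq[OF sets_m] by simp

context
  fixes S B
  assumes S: "S \<in> sets m" and B: "B \<in> sets M"
begin

lemma visits_pair_sets:
  "{z \<in> space (M \<Otimes>\<^sub>M m). snd z \<in> S \<and> act (fst z) (snd z) \<in> B} \<in> sets (M \<Otimes>\<^sub>M m)"
proof -
  have [measurable]: "(\<lambda>z. act (fst z) (snd z)) \<in> M \<Otimes>\<^sub>M m \<rightarrow>\<^sub>M M"
    using act_measurable by (simp add: case_prod_beta')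
  show ?thesis using S B by measurable
qed

lemma visits_section:
  "x \<in> space M \<Longrightarrow>
    Pair x -` {z \<in> space (M \<Otimes>\<^sub>M m). snd z \<in> S \<and> act (fst z) (snd z) \<in> B} = visits act S B x"
  by (auto simp: visits_def space_pair_measure space_m)

lemma visits_sets: "x \<in> space M \<Longrightarrow> visits act S B x \<in> sets m"
  by (rule subst[of _ _ "\<lambda>V. V \<in> sets m", OF visits_section sets_Pair1[OF visits_pair_sets]])

lemma emeasure_visits_measurable: "(\<lambda>x. emeasure m (visits act S B x)) \<in> borel_measurable M"
  by (rule measurable_cong[THEN iffD1, OF _ m.measurable_emeasure_Pair[OF visits_pair_sets]])
    (simp only: visits_section)

text \<open>Tonelli: for \<open>h\<close> in \<open>S\<close> the slice is the preimage of
  \<open>B\<close> under translation by \<open>h\<close>, and invariance gives it the measure of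
  \<open>B\<close>; other slices are empty.\<close>

lemma nn_integral_visits:
  "(\<integral>\<^sup>+x. emeasure m (visits act S B x) \<partial>M) = emeasure m S * emeasure M B"
proof -
  interpret P: pair_sigma_finite M m ..
  let ?E = "{z \<in> space (M \<Otimes>\<^sub>M m). snd z \<in> S \<and> act (fst z) (snd z) \<in> B}"
  have slice: "emeasure M ((\<lambda>x. (x, h)) -` ?E) = emeasure M B * indicator S h" for h
  proof (cases "h \<in> S")
    case True
    have "(\<lambda>x. act x h) \<in> M \<rightarrow>\<^sub>M M"
      using measurable_compose[OF measurable_Pair2' act_measurable, of h] by (simp add: space_m)
    then have "emeasure (distr M M (\<lambda>x. act x h)) B = emeasure M ((\<lambda>x. act x h) -` B \<inter> space M)"
      using B by (rule emeasure_distr)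
    moreover have "(\<lambda>x. (x, h)) -` ?E = (\<lambda>x. act x h) -` B \<inter> space M"
      using True by (auto simp: space_pair_measure space_m)
    ultimately show ?thesis
      using True action by (simp add: measure_preserving_right_action_def)
  qed simp
  have "(\<integral>\<^sup>+x. emeasure m (visits act S B x) \<partial>M) = (\<integral>\<^sup>+x. emeasure m (Pair x -` ?E) \<partial>M)"
    by (intro nn_integral_cong) (simp only: visits_section)
  also have "\<dots> = (\<integral>\<^sup>+h. emeasure M ((\<lambda>x. (x, h)) -` ?E) \<partial>m)"
    using m.emeasure_pair_measure_alt[OF visits_pair_sets]
      P.emeasure_pair_measure_alt2[OF visits_pair_sets] by simp
  also have "\<dots> = emeasure m S * emeasure M B"
    unfolding slice using S by (subst nn_integral_cmult) (auto simp: mult.commute)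
  finally show ?thesis .
qed

lemma integral_visits:
  assumes "emeasure m S < \<infinity>" "emeasure M B < \<infinity>"
  shows "integrable M (\<lambda>x. measure m (visits act S B x))"
    and "(\<integral>x. measure m (visits act S B x) \<partial>M) = measure m S * measure M B"
proof -
  have fin: "emeasure m (visits act S B x) < \<infinity>" if "x \<in> space M" for x
    by (rule order.strict_trans1[OF emeasure_mono[OF _ S] assms(1)]) (auto simp: visits_def)
  have meas: "(\<lambda>x. measure m (visits act S B x)) \<in> borel_measurable M"
    using emeasure_visits_measurable unfolding measure_def by measurable
  have nn: "(\<integral>\<^sup>+x. ennreal (measure m (visits act S B x)) \<partial>M) = emeasure m S * emeasure M B"
    using fin by (subst nn_integral_visits[symmetric], intro nn_integral_cong)
      (simp add: emeasure_eq_ennreal_measure less_top)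
  then show "integrable M (\<lambda>x. measure m (visits act S B x))"
    using assms meas by (intro integrableI_nonneg) (auto simp: ennreal_mult_less_top)
  show "(\<integral>x. measure m (visits act S B x) \<partial>M) = measure m S * measure M B"
    using meas nn by (simp add: integral_eq_nn_integral measure_def enn2real_mult)
qed

end

end

section \<open>Mean ergodic estimate for the proportion of visits\<close>

lemma (in prob_space) expectation_le_sqrt_expectation_square:
  fixes X :: "'a \<Rightarrow> real"
  assumes "integrable M X" "integrable M (\<lambda>x. (X x)\<^sup>2)"
  shows "expectation X \<le> sqrt (expectation (\<lambda>x. (X x)\<^sup>2))"
proof -
  \<comment> \<open>This is Cauchy-Schwarz against the constant 1.\<close>
  have "0 \<le> variance X" by (intro integral_nonneg_AE) simp
  then show ?thesis
    using variance_eq[OF assms] by (intro real_le_rsqrt) simp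
qed

text \<open>Turns the complex average of the ergodic hypothesis into a real proportion of
  visits.\<close>

lemma ball_average_indicator:
  assumes "visits act (norm_ball N t) B x \<in> sets m"
    and "emeasure m (norm_ball N t) < \<infinity>" "norm_ball N t \<in> sets m"
  shows "ball_average m N act t (indicator B) x =
    of_real (measure m (visits act (norm_ball N t) B x) / measure m (norm_ball N t))"
proof -
  have "(LINT h:norm_ball N t|m. indicator B (act x h) :: complex)
      = (LINT h|m. of_real (indicator (visits act (norm_ball N t) B x) h))"
    unfolding set_lebesgue_integral_def
    by (intro Bochner_Integration.integral_cong) (auto simp: visits_def indicator_def)
  also have "\<dots> = of_real (measure m (visits act (norm_ball N t) B x))"
  proof -
    have "emeasure m (visits act (norm_ball N t) B x) < \<infinity>"
      by (rule order.strict_trans1[OF emeasure_mono[OF _ assms(3)] assms(2)]) (auto simp: visits_def)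
    then show ?thesis
      using sets.Int_space_eq2[OF assms(1)] assms(1)
      by (simp only: integral_complex_of_real integral_indicator) simp
  qed
  finally show ?thesis by (simp add: ball_average_def)
qed


text \<open>The deficit \<open>a - p\<close>, integrated over \<open>B\<close>, is estimated from
  below by \<open>few\<close> and invariance, and from above by Cauchy-Schwarz and the ergodic
  theorem.\<close>

lemma (in sigma_finite_action) mean_ergodic_visits_bound:
  fixes N B A C t R
  defines "T \<equiv> measure m (norm_ball N t)" and "a \<equiv> measure M A"
  assumes M: "prob_space M" and N: "group_norm N"
    and finite_ball: "\<And>t. emeasure m (norm_ball N t) < \<infinity>"
    and A: "A \<in> sets M" and B: "B \<in> sets M" and T: "T > 0"
    and ergodic: "\<And>f. f \<in> L2_space M \<Longrightarrow>
      L2_norm M (\<lambda>x. ball_average m N act t f x - (\<integral>y. f y \<partial>M)) \<le> C * T powr (- \<kappa>) * L2_norm M f"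
    and few: "\<And>x. x \<in> B \<Longrightarrow>
      measure m (visits act (norm_ball N t) A x) \<le> measure m (visits act (norm_ball N R) A x)"
  shows "measure M B * a - measure m (norm_ball N R) * a / T \<le> C * T powr (- \<kappa>) * sqrt a"
proof -
  interpret prob_space M by (fact M)
  have ball: "norm_ball N s \<in> sets m" for s
    using norm_ball_sets_borel[OF N] sets_m by simp
  \<comment> \<open>\<open>p\<close> is the ball average of the indicator of \<open>A\<close>;
    \<open>q\<close> counts only the visits in the ball of radius \<open>R\<close> but is still
    normalized by \<open>T\<close>.\<close>
  define p where "p x = measure m (visits act (norm_ball N t) A x) / T" for x
  define q where "q x = measure m (visits act (norm_ball N R) A x) / T" for x
  have A_finite: "emeasure M A < \<infinity>"
    by (simp add: less_top[symmetric])
  have p: "integrable M p"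
    using integral_visits[OF ball A finite_ball A_finite, of t]
    unfolding p_def by simp
  have q: "integrable M q" "expectation q = measure m (norm_ball N R) * a / T"
    using integral_visits[OF ball A finite_ball A_finite, of R]
    unfolding q_def a_def by simp_all
  have p_range: "0 \<le> p x \<and> p x \<le> 1" for x
  proof -
    have "measure m (visits act (norm_ball N t) A x) \<le> T"
      unfolding T_def measure_def
      by (rule enn2real_mono[OF emeasure_mono[OF _ ball]]) (use finite_ball in \<open>auto simp: visits_def\<close>)
    then show ?thesis using T by (simp add: p_def)
  qed
  have a: "0 \<le> a" "a \<le> 1" by (simp_all add: a_def)
  have pa: "(p x - a)\<^sup>2 \<le> 1" for x
    using p_range[of x] a by (intro abs_square_le_1[THEN iffD2]) auto
  have [measurable]: "p \<in> borel_measurable M" "B \<in> sets M" "A \<in> sets M"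
    using p A B by auto
  have int_pa: "integrable M (\<lambda>x. (p x - a)\<^sup>2)"
    by (rule integrable_const_bound[of _ 1]) (use pa in auto)
  \<comment> \<open>Keeping the cutoff to \<open>B\<close> inside the square lets it be dropped
    afterwards, since \<open>Y\<close> is dominated by the deviation \<open>p - a\<close> on the
    whole space.\<close>
  define Y where "Y x = indicator B x * (a - p x)" for x
  have Y2: "(Y x)\<^sup>2 \<le> (p x - a)\<^sup>2" for x
    by (auto simp: Y_def indicator_def power2_commute)
  have int_Y2: "integrable M (\<lambda>x. (Y x)\<^sup>2)"
    by (rule integrable_const_bound[of _ 1])
      (use order_trans[OF Y2 pa] in \<open>auto simp: Y_def\<close>)
  have int_Bp: "integrable M (\<lambda>x. indicator B x * p x)"
    by (rule integrable_const_bound[of _ 1]) (use p_range in \<open>auto simp: indicator_def\<close>)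
  have int_B: "integrable M (\<lambda>x. indicator B x :: real)"
    by (rule integrable_const_bound[of _ 1]) auto
  have int_Y: "integrable M Y"
    unfolding Y_def right_diff_distrib using int_Bp int_B
    by (intro Bochner_Integration.integrable_diff) auto
  have cmod_A: "(cmod (indicator A x))\<^sup>2 = indicator A x" for x
    by (simp add: indicator_def)
  \<comment> \<open>On \<open>B\<close> this is \<open>few\<close>; elsewhere the left side
    vanishes. Passing to the whole space makes the integral of \<open>q\<close> exactly
    computable.\<close>
  have "expectation (\<lambda>x. indicator B x * p x) \<le> expectation q"
    using few T p_range by (intro integral_mono int_Bp q)
      (auto simp: indicator_def p_def q_def divide_right_mono)
  moreover have "expectation Y = measure M B * a - expectation (\<lambda>x. indicator B x * p x)"
    unfolding Y_def right_diff_distrib using int_Bp int_B B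
    by (subst Bochner_Integration.integral_diff) auto
  ultimately have "measure M B * a - measure m (norm_ball N R) * a / T \<le> expectation Y"
    using q(2) by simp
  also have "\<dots> \<le> sqrt (expectation (\<lambda>x. (Y x)\<^sup>2))"
    by (rule expectation_le_sqrt_expectation_square[OF int_Y int_Y2])
  also have "\<dots> \<le> sqrt (expectation (\<lambda>x. (p x - a)\<^sup>2))"
    by (intro real_sqrt_le_mono integral_mono int_Y2 int_pa Y2)
  also have "\<dots> = L2_norm M (\<lambda>x. ball_average m N act t (indicator A) x - (\<integral>y. indicator A y \<partial>M))"
  proof -
    have "(\<integral>y. of_real (indicator A y) \<partial>M) = complex_of_real (measure M A)"
      by (simp only: integral_complex_of_real integral_indicator) (simp add: A)
    moreover have "of_real (indicator A y) = (indicator A y :: complex)" for y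
      by (simp add: indicator_def)
    ultimately have mean: "(\<integral>y. indicator A y \<partial>M) = complex_of_real a"
      unfolding a_def by simp
    have "ball_average m N act t (indicator A) x = of_real (p x)" if "x \<in> space M" for x
      unfolding p_def T_def
      using ball_average_indicator[OF visits_sets[OF ball A that] finite_ball ball] .
    then show ?thesis
      unfolding L2_norm_def mean
      by (intro arg_cong[of _ _ sqrt] Bochner_Integration.integral_cong refl)
        (simp flip: of_real_diff)
  qed
  also have "\<dots> \<le> C * T powr (- \<kappa>) * L2_norm M (indicator A :: 'x \<Rightarrow> complex)"
  proof (rule ergodic)
    have "integrable M (\<lambda>x. indicator A x :: real)"
      by (rule integrable_const_bound[of _ 1]) auto
    then show "(indicator A :: 'x \<Rightarrow> complex) \<in> L2_space M"
      by (simp add: L2_space_def cmod_A)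
  qed
  also have "L2_norm M (indicator A :: 'x \<Rightarrow> complex) = sqrt a"
    by (simp add: L2_norm_def cmod_A a_def A)
  finally show ?thesis .
qed

section \<open>Comparison of powers of the radius\<close>

lemma eventually_less_powr:
  fixes e L :: real
  assumes "e > 0"
  shows "\<forall>\<^sub>F n in sequentially. L < real n powr e"
proof -
  have "\<forall>\<^sub>F n in sequentially. \<bar>L\<bar> powr (1 / e) < real n"
    using filterlim_real_sequentially by (simp add: filterlim_at_top_dense)
  then show ?thesis
  proof eventually_elim
    case (elim n)
    have "(\<bar>L\<bar> powr (1 / e)) powr e < real n powr e"
      using assms elim by (intro powr_less_mono2) auto
    then show ?case using assms by (simp add: powr_powr)
  qed
qed

text \<open>Once the \<open>K\<close> term is absorbed, \<open>sqrt (a s)\<close> is at most of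
  order \<open>T n powr (- \<kappa>)\<close>. With the lower bounds for \<open>a\<close> and
  \<open>T\<close> this bounds a positive power of \<open>n\<close>.\<close>

lemma growth_contradiction:
  fixes T :: "nat \<Rightarrow> real" and a :: "real \<Rightarrow> real"
  assumes pos: "0 < b" "0 < c" "0 < c1" "0 < \<kappa>" "0 < \<delta>" "0 \<le> \<eta>" "\<eta> < 2 * \<kappa> * \<delta>"
    and growth: "\<forall>\<^sub>F n in sequentially. real n powr \<delta> \<le> c1 * T n"
    and a: "\<And>t. 1 \<le> t \<Longrightarrow> 1 / (c * t) \<le> a t"
    and bound: "\<And>n. 1 \<le> n \<Longrightarrow> T n > 0 \<Longrightarrow>
      b * a (real n powr \<eta>) - K * a (real n powr \<eta>) / T n
        \<le> C * T n powr (- \<kappa>) * sqrt (a (real n powr \<eta>))"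
  shows False
proof -
  \<comment> \<open>The factor \<open>2 / b\<close> comes from dividing by \<open>b / 2\<close>,
    \<open>sqrt c\<close> from the lower bound for \<open>a\<close>, and
    \<open>c1 powr \<kappa>\<close> from the growth of \<open>T\<close>.\<close>
  define L where "L = C * sqrt c * 2 / b * c1 powr \<kappa>"
  have "\<forall>\<^sub>F n in sequentially. real n powr (\<delta> * \<kappa> - \<eta> / 2) \<le> L"
    using growth eventually_less_powr[OF \<open>0 < \<delta>\<close>, of "2 * K * c1 / b"] eventually_ge_at_top[of 1]
  proof eventually_elim
    case (elim n)
    define s where "s = real n powr \<eta>"
    have s: "1 \<le> s" using elim pos by (simp add: s_def ge_one_powr_ge_zero)
    have "0 < 1 / (c * s)" using s pos by simp
    then have as: "0 < a s" using a[OF s] by linarith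
    have "0 < real n powr \<delta>" using elim by simp
    then have "0 < c1 * T n" using elim by linarith
    then have T: "0 < T n" using pos by (simp add: zero_less_mult_iff)
    \<comment> \<open>For large \<open>n\<close> the \<open>K\<close> term costs at most half of
      \<open>b * a s\<close>.\<close>
    have "2 * K * c1 / b < c1 * T n" using elim by linarith
    then have "K / T n \<le> b / 2" using T pos by (simp add: field_simps)
    then have "K / T n * a s \<le> b / 2 * a s"
      using as by (intro mult_right_mono) auto
    then have "b / 2 * a s \<le> C * T n powr (- \<kappa>) * sqrt (a s)"
      using bound[OF _ T] elim(3) unfolding s_def by simp
    then have "b / 2 * sqrt (a s) * sqrt (a s) \<le> C * T n powr (- \<kappa>) * sqrt (a s)"
      using as by (simp add: mult.assoc)
    then have 1: "b / 2 * sqrt (a s) \<le> C * T n powr (- \<kappa>)"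
      using as by simp
    have "sqrt (1 / (c * s)) \<le> sqrt (a s)"
      using a[OF s] by (rule real_sqrt_le_mono)
    then have "b / 2 * sqrt (1 / (c * s)) \<le> b / 2 * sqrt (a s)"
      using pos by (intro mult_left_mono) auto
    then have "b / 2 * sqrt (1 / (c * s)) \<le> C * T n powr (- \<kappa>)"
      using 1 by linarith
    \<comment> \<open>Naming the powers and roots leaves a rational inequality between positive
      quantities, to be inverted.\<close>
    moreover define u w where "u = T n powr \<kappa>" and "w = sqrt c * sqrt s"
    ultimately have "b / 2 * (1 / w) \<le> C * (1 / u)"
      by (simp add: powr_minus_divide real_sqrt_divide real_sqrt_mult)
    moreover have "0 < u" "0 < w" using T pos s by (auto simp: u_def w_def)
    ultimately have "u \<le> C * 2 / b * w"
      using pos by (simp add: field_simps)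
    then have 2: "T n powr \<kappa> \<le> C * sqrt c * 2 / b * sqrt s"
      by (simp add: u_def w_def mult.assoc mult.left_commute)
    have "(real n powr \<delta>) powr \<kappa> \<le> (c1 * T n) powr \<kappa>"
      using elim pos by (intro powr_mono2) auto
    then have "real n powr (\<delta> * \<kappa>) \<le> c1 powr \<kappa> * T n powr \<kappa>"
      using pos T by (simp add: powr_powr powr_mult)
    also have "\<dots> \<le> c1 powr \<kappa> * (C * sqrt c * 2 / b * sqrt s)"
      by (intro mult_left_mono 2) auto
    also have "\<dots> = L * real n powr (\<eta> / 2)"
      using powr_half_sqrt[of s] by (simp add: L_def s_def powr_powr)
    finally show ?case
      using elim by (simp only: powr_diff) (simp add: pos_divide_le_eq)
  qed
  moreover have "\<forall>\<^sub>F n in sequentially. L < real n powr (\<delta> * \<kappa> - \<eta> / 2)"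
    using pos by (intro eventually_less_powr) (simp add: mult.commute)
  ultimately have "\<forall>\<^sub>F n::nat in sequentially. False"
    by eventually_elim simp
  then show False by simp
qed

section \<open>A set of positive measure with uniformly bounded essential visits\<close>

lemma (in sigma_finite_action) few_visits_set:
  assumes M: "prob_space M" and N: "group_norm N" and A: "shrinking_targets M A"
    and eta: "0 < \<eta>"
    and finite_ball: "\<And>t. emeasure m (norm_ball N t) < \<infinity>"
    and less: "AE x in M. critical_exponent_at N act A x < ereal \<eta>"
  obtains R B where "B \<in> sets M" "measure M B > 0"
    "\<And>x n. x \<in> B \<Longrightarrow> 1 \<le> n \<Longrightarrow>
      measure m (visits act (norm_ball N (real n)) (A (real n powr \<eta>)) x)
        \<le> measure m (visits act (norm_ball N R) (A (real n powr \<eta>)) x)"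
proof -
  interpret prob_space M by (fact M)
  have ball: "norm_ball N s \<in> sets m" for s
    using norm_ball_sets_borel[OF N] sets_m by simp
  \<comment> \<open>Starting at \<open>n = 1\<close> keeps the index in the range where
    \<open>A\<close> is controlled.\<close>
  have one_le: "1 \<le> real n powr \<eta>" if "1 \<le> n" for n
    using that eta by (simp add: ge_one_powr_ge_zero)
  have An: "A (real n powr \<eta>) \<in> sets M" if "1 \<le> n" for n
    using A one_le[OF that] by (simp add: shrinking_targets_def)
  define V where "V k n x =
    visits act (norm_ball N (real n) - norm_ball N (real k)) (A (real n powr \<eta>)) x" for k n x
  \<comment> \<open>Nullity for integer \<open>n\<close> makes \<open>B k\<close> measurable;
    emptiness of \<open>V k n x\<close> would be a condition on uncountably many
    \<open>h\<close>.\<close>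
  define B where "B k = {x \<in> space M. \<forall>n\<ge>1. emeasure m (V k n x) = 0}" for k
  have B: "B k \<in> sets M" for k
  proof -
    have "{x \<in> space M. emeasure m (V k n x) = 0} \<in> sets M" if "1 \<le> n" for n
      using emeasure_visits_measurable[OF sets.Diff[OF ball ball] An[OF that]]
      unfolding V_def by measurable
    then have "{x \<in> space M. 1 \<le> n \<longrightarrow> emeasure m (V k n x) = 0} \<in> sets M" for n
      by (cases "1 \<le> n") auto
    then show ?thesis unfolding B_def by measurable
  qed
  have cover: "AE x in M. x \<in> (\<Union>k. B k)"
    using less AE_space
  proof eventually_elim
    case (elim x)
    then obtain \<eta>' where eta': "0 \<le> \<eta>'" "\<eta>' < \<eta>" "bdd_above (N ` hitting_set N act A \<eta>' x)"
      unfolding critical_exponent_at_def INF_less_iff by auto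
    then obtain r where r: "\<And>h. h \<in> hitting_set N act A \<eta>' x \<Longrightarrow> N h \<le> r"
      by (auto simp: bdd_above_def)
    \<comment> \<open>The bound \<open>r\<close> excludes hits beyond radius \<open>k\<close>; the
      bound 1 makes powers of \<open>N h\<close> increase with the exponent there.\<close>
    obtain k :: nat where k: "max 1 r \<le> real k"
      using real_arch_simple by blast
    have "V k n x = {}" if n: "1 \<le> n" for n
    proof -
      have False if h: "N h \<le> real n" "real k < N h" "act x h \<in> A (real n powr \<eta>)" for h
      proof -
        have 1: "1 \<le> N h powr \<eta>'"
          using h k eta' by (intro ge_one_powr_ge_zero) auto
        \<comment> \<open>A hit of the smaller target with index \<open>real n powr \<eta>\<close>
          is also a hit of the target with index \<open>N h powr \<eta>'\<close>, since the family
          decreases.\<close>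
        have "N h powr \<eta>' \<le> N h powr \<eta>"
          using h k eta' by (intro powr_mono) auto
        also have "\<dots> \<le> real n powr \<eta>"
          using h k eta by (intro powr_mono2) auto
        finally have "A (real n powr \<eta>) \<subseteq> A (N h powr \<eta>')"
          using A 1 by (simp add: shrinking_targets_def)
        then have "h \<in> hitting_set N act A \<eta>' x"
          using h 1 by (auto simp: hitting_set_def)
        then show False using r[of h] h k by simp
      qed
      then show ?thesis by (force simp: V_def visits_def norm_ball_def)
    qed
    then have "x \<in> B k" using elim by (simp add: B_def)
    then show ?case by blast
  qed
  \<comment> \<open>Countably many null sets cannot cover almost all of a probability space.\<close>
  have "\<exists>k. measure M (B k) > 0"
  proof (rule ccontr)
    assume "\<not> ?thesis"
    then have "measure M (B k) = 0" for k
      by (simp add: zero_less_measure_iff)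
    then have "AE x in M. x \<notin> B k" for k
      using B by (intro AE_not_in) (simp add: null_sets_def emeasure_eq_measure)
    then have "AE x in M. \<forall>k. x \<notin> B k"
      by (simp add: AE_all_countable)
    with cover have "AE x in M. False" by eventually_elim auto
    then show False by simp
  qed
  then obtain k where k: "measure M (B k) > 0" by blast
  show thesis
  proof (rule that[OF B k, of "real k"])
    fix x and n :: nat assume x: "x \<in> B k" and n: "1 \<le> n"
    let ?A = "A (real n powr \<eta>)"
    have xM: "x \<in> space M" and null: "emeasure m (V k n x) = 0"
      using x n by (auto simp: B_def)
    have sets: "visits act (norm_ball N (real k)) ?A x \<in> sets m" "V k n x \<in> sets m"
      using visits_sets[OF _ An[OF n] xM] ball unfolding V_def by auto
    have "emeasure m (visits act (norm_ball N (real n)) ?A x)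
        \<le> emeasure m (visits act (norm_ball N (real k)) ?A x \<union> V k n x)"
      using sets by (intro emeasure_mono) (auto simp: V_def visits_def)
    also have "\<dots> = emeasure m (visits act (norm_ball N (real k)) ?A x)"
      using sets null by (intro emeasure_Un_null_set) auto
    finally show "measure m (visits act (norm_ball N (real n)) ?A x)
        \<le> measure m (visits act (norm_ball N (real k)) ?A x)"
      unfolding measure_def
      by (rule enn2real_mono)
        (rule order.strict_trans1[OF emeasure_mono[OF _ ball[of "real k"]]],
          use finite_ball in \<open>auto simp: visits_def\<close>)
  qed
qed

section \<open>The lower bound for the critical exponent\<close>

theorem theorem1:
  fixes M :: "'x measure"
    and m :: "'h::{topological_group_add,t2_space} measure"
    and N :: "'h \<Rightarrow> real"
    and act :: "'x \<Rightarrow> 'h \<Rightarrow> 'x"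
    and A :: "real \<Rightarrow> 'x set"
    and \<kappa> d_minus d_plus :: real
    and \<alpha> :: ereal
  assumes "locally_compact_space (euclidean :: 'h topology)"
    and "left_haar_measure m \<or> right_haar_measure m"
    and "prob_space M"
    and "ergodic_right_action M act"
    and "group_norm N"
    and "growth_exponents m N d_minus d_plus"
    and "shrinking_targets M A"
    and "effective_mean_ergodic M m N act \<kappa>"
    and "is_critical_exponent M N act A \<alpha>"
  shows "\<alpha> \<ge> ereal (2 * \<kappa> * d_minus)"
proof (rule ccontr)
  interpret prob_space M by fact
  assume "\<not> \<alpha> \<ge> ereal (2 * \<kappa> * d_minus)"
  then obtain \<eta> where eta: "\<alpha> < ereal \<eta>" "\<eta> < 2 * \<kappa> * d_minus"
    using ereal_dense2[of \<alpha> "ereal (2 * \<kappa> * d_minus)"] by (auto simp: not_le)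
  have "sets m = sets borel"
    using assms(2) by (auto simp: left_haar_measure_def right_haar_measure_def radon_measure_def)
  moreover have finite_ball: "emeasure m (norm_ball N t) < \<infinity>" for t
    using assms(6) by (simp add: growth_exponents_def)
  ultimately interpret m: sigma_finite_measure m
    using sigma_finite_if_finite_balls[OF _ assms(5)] by blast
  interpret sigma_finite_action M m act
    using \<open>sets m = sets borel\<close> assms(4) by unfold_locales (auto simp: ergodic_right_action_def)
  have less: "AE x in M. critical_exponent_at N act A x < ereal \<eta>"
    using assms(9) eta(1) unfolding is_critical_exponent_def by (auto elim: eventually_mono)
  \<comment> \<open>\<alpha> is an arbitrary extended real, so the sign of \<eta> is read off at a
    point: an infimum of nonnegative numbers, possibly of none, is nonnegative.\<close>
  have eta_pos: "0 < \<eta>"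
  proof -
    have "AE x in M. 0 < \<eta>"
      using less
    proof eventually_elim
      case (elim x)
      have "0 \<le> critical_exponent_at N act A x"
        unfolding critical_exponent_at_def by (intro INF_greatest) auto
      then show ?case using elim by (metis ereal_less(2) order_le_less_trans)
    qed
    then show ?thesis by simp
  qed
  obtain C where kappa: "\<kappa> > 0" and ergodic: "\<And>f t. f \<in> L2_space M \<Longrightarrow> measure m (norm_ball N t) > 0 \<Longrightarrow>
      L2_norm M (\<lambda>x. ball_average m N act t f x - (\<integral>y. f y \<partial>M))
        \<le> C * measure m (norm_ball N t) powr (- \<kappa>) * L2_norm M f"
    using assms(8) unfolding effective_mean_ergodic_def by blast
  obtain c where c: "c > 1" "\<And>t. t \<ge> 1 \<Longrightarrow> 1 / (c * t) \<le> measure M (A t)"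
    using assms(7) unfolding shrinking_targets_def by blast
  obtain R B where B: "B \<in> sets M" "measure M B > 0"
    "\<And>x n. x \<in> B \<Longrightarrow> 1 \<le> n \<Longrightarrow>
      measure m (visits act (norm_ball N (real n)) (A (real n powr \<eta>)) x)
        \<le> measure m (visits act (norm_ball N R) (A (real n powr \<eta>)) x)"
    using few_visits_set[OF assms(3,5,7) eta_pos finite_ball less] by metis
  have "\<eta> / (2 * \<kappa>) < d_minus"
    using eta(2) kappa by (simp add: field_simps)
  \<comment> \<open>Growth is available only strictly below \<open>d_minus\<close>, with \<epsilon>
    taken as \<open>d_minus - \<delta>\<close>; the other inequality gives
    \<open>\<eta> < 2 * \<kappa> * \<delta>\<close>.\<close>
  then obtain \<delta> where delta: "\<eta> / (2 * \<kappa>) < \<delta>" "\<delta> < d_minus"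
    using dense by blast
  have "(\<lambda>t. t powr (d_minus - (d_minus - \<delta>))) \<in> O(\<lambda>t. measure m (norm_ball N t))"
    using assms(6) delta(2) unfolding growth_exponents_def by (meson diff_gt_0_iff_gt)
  then have "(\<lambda>t. t powr \<delta>) \<in> O(\<lambda>t. measure m (norm_ball N t))"
    by simp
  then obtain c1 where c1: "c1 > 0"
    "\<forall>\<^sub>F t in at_top. norm (t powr \<delta>) \<le> c1 * norm (measure m (norm_ball N t))"
    by (elim landau_o.bigE)
  have growth: "\<forall>\<^sub>F n in sequentially.
      real n powr \<delta> \<le> c1 * measure m (norm_ball N (real n))"
    using eventually_compose_filterlim[OF c1(2) filterlim_real_sequentially] by simp
  show False
  proof (rule growth_contradiction[of "measure M B" c c1 \<kappa> \<delta> \<eta>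
      "\<lambda>n. measure m (norm_ball N (real n))" "\<lambda>t. measure M (A t)" "measure m (norm_ball N R)" C])
    have "0 < \<eta> / (2 * \<kappa>)" using eta_pos kappa by simp
    then show "0 < \<delta>" using delta(1) by linarith
    show "\<eta> < 2 * \<kappa> * \<delta>" using delta(1) kappa by (simp add: field_simps)
  next
    fix n :: nat assume n: "1 \<le> n" "0 < measure m (norm_ball N (real n))"
    have "1 \<le> real n powr \<eta>"
      using n eta_pos by (simp add: ge_one_powr_ge_zero)
    then have "A (real n powr \<eta>) \<in> sets M"
      using assms(7) by (simp add: shrinking_targets_def)
    from mean_ergodic_visits_bound[OF assms(3,5) finite_ball this B(1) n(2) ergodic[OF _ n(2)] B(3)[OF _ n(1)]]
    show "measure M B * measure M (A (real n powr \<eta>))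
        - measure m (norm_ball N R) * measure M (A (real n powr \<eta>)) / measure m (norm_ball N (real n))
      \<le> C * measure m (norm_ball N (real n)) powr (- \<kappa>) * sqrt (measure M (A (real n powr \<eta>)))" .
  qed (use B(2) c c1(1) kappa eta_pos growth in auto)
qed

end
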